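(* Let $P=\{x\in\mathbb{R}^n \mid Ax\le b\}$ be a nonempty rational polytope. Using this description of $P$ and an explicit list of the elements of a set $X\subseteq \mathrm{vert}(P)$ of vertices of $P$, one can construct an extended formulation of $\mathrm{forb}(P,X)$ that requires at most $f(P)^{|X|+1}$ inequalities; i.e., $$\mathrm{xc}(\mathrm{forb}(P,X))\le f(P)^{|X|+1}.$$
   Context: $\mathrm{vert}(P)$ is the set of vertices of a polytope $P$, and $f(P)$ is the number of facets of $P$. For $X\subseteq\mathrm{vert}(P)$, $\mathrm{forb}(P,X):=\mathrm{conv}(\mathrm{vert}(P)\setminus X)$, where $\mathrm{conv}$ denotes convex hull. An extended formulation of a polytope $P$ is a description by linear equations and inequalities of a polyhedron whose image under a linear map is $P$. The extension complexity $\mathrm{xc}(P)$ is the minimum number of inequalities in any extended formulation of $P$ (equations are not counted). *)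

theory Defs
  imports "HOL-Analysis.Analysis" "HOL-Library.Extended_Nat"
begin

definition vert :: "'a::euclidean_space set \<Rightarrow> 'a set" where
  "vert P = {v. v extreme_point_of P}"

definition num_facets :: "'a::euclidean_space set \<Rightarrow> nat" where
  "num_facets P = card {F. F facet_of P}"

definition forb :: "'a::euclidean_space set \<Rightarrow> 'a set \<Rightarrow> 'a set" where
  "forb P X = convex hull (vert P - X)"

text \<open>
  The dimension of the lifted space is part of an extended formulation, so it has to be a number
  and not a type: the space of dimension q is the set of functions on the indices below q.
  A constraint is a coefficient vector together with a right-hand side. The linear
  map into the space of the polytope is given by its matrix.
\<close>

type_synonym lin_constraint = "(nat \<Rightarrow> real) \<times> real"

record 'n ext_form =
  ef_dim :: nat
  ef_ineqs :: "lin_constraint list"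
  ef_eqs :: "lin_constraint list"
  ef_map :: "'n \<Rightarrow> nat \<Rightarrow> real"

definition ef_polyhedron :: "'n ext_form \<Rightarrow> (nat \<Rightarrow> real) set" where
  "ef_polyhedron E =
    {y \<in> {..<ef_dim E} \<rightarrow>\<^sub>E UNIV.
       (\<forall>(c, d) \<in> set (ef_ineqs E). (\<Sum>j<ef_dim E. c j * y j) \<le> d) \<and>
       (\<forall>(c, d) \<in> set (ef_eqs E). (\<Sum>j<ef_dim E. c j * y j) = d)}"

definition ef_proj :: "'n ext_form \<Rightarrow> (nat \<Rightarrow> real) \<Rightarrow> real ^ 'n" where
  "ef_proj E y = (\<chi> i. \<Sum>j<ef_dim E. ef_map E i j * y j)"

definition ext_formulation_of :: "'n ext_form \<Rightarrow> (real ^ 'n) set \<Rightarrow> bool" where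
  "ext_formulation_of E P \<longleftrightarrow> ef_proj E ` ef_polyhedron E = P"

definition rational_ext_form :: "'n ext_form \<Rightarrow> bool" where
  "rational_ext_form E \<longleftrightarrow>
    (\<forall>(c, d) \<in> set (ef_ineqs E) \<union> set (ef_eqs E). d \<in> \<rat> \<and> (\<forall>j<ef_dim E. c j \<in> \<rat>)) \<and>
    (\<forall>i. \<forall>j<ef_dim E. ef_map E i j \<in> \<rat>)"

text \<open>
  The infimum in the extended naturals is the minimum whenever an extended formulation exists,
  and infinity otherwise, so a finite upper bound on it always has a witness.
\<close>

definition xc :: "(real ^ 'n) set \<Rightarrow> enat" where
  "xc P = (INF E \<in> {E. ext_formulation_of E P}. enat (length (ef_ineqs E)))"

end

theory Submission
  imports Defs
begin

text \<open>
  Describe P by irredundant inequalities, one per facet, together with the rows that hold with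
  equality on all of P. If w and v are distinct vertices, some inequality is tight at w but not
  at v. So a vertex outside X lies on a face obtained by choosing, for every v in X, an inequality
  that is not tight at v and turning it into an equation; conversely the vertices of such a face
  are vertices of P outside X. Hence forb(P, X) is the convex hull of the union of at most
  f(P)^|X| faces, to which Balas' disjunctive formulation applies: each face is homogenised with
  a multiplier, and boundedness makes a zero multiplier force a zero point.
\<close>

section \<open>Extended formulations with arbitrarily indexed coordinates\<close>

text \<open>A bijection from the numbers below \<open>card J\<close> onto \<open>J\<close> renumbers
  the coordinates, so later constructions may use structured indices such as pairs. The inequalities
  are listed from a distinct enumeration of \<open>L\<close>, which makes the count exact.\<close>

lemma finite_index_ext_form:
  fixes J :: "'j set" and L K :: "(('j \<Rightarrow> real) \<times> real) set" and M :: "'n::finite \<Rightarrow> 'j \<Rightarrow> real"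
  assumes "finite J" "finite L" "finite K"
    and rat: "\<And>c d. (c, d) \<in> L \<union> K \<Longrightarrow> d \<in> \<rat> \<and> (\<forall>j\<in>J. c j \<in> \<rat>)"
    and ratM: "\<And>i j. j \<in> J \<Longrightarrow> M i j \<in> \<rat>"
  shows "\<exists>E :: 'n ext_form.
    ext_formulation_of E ((\<lambda>y. \<chi> i. \<Sum>j\<in>J. M i j * y j) `
      {y. (\<forall>(c, d)\<in>L. (\<Sum>j\<in>J. c j * y j) \<le> d) \<and> (\<forall>(c, d)\<in>K. (\<Sum>j\<in>J. c j * y j) = d)}) \<and>
    rational_ext_form E \<and> length (ef_ineqs E) = card L"
proof -
  obtain h where h: "bij_betw h {..<card J} J"
    using ex_bij_betw_nat_finite[OF \<open>finite J\<close>] by (auto simp: atLeast0LessThan)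
  obtain Ll where Ll: "set Ll = L" "length Ll = card L"
    using \<open>finite L\<close> by (metis finite_distinct_list distinct_card)
  obtain Kl where Kl: "set Kl = K" using \<open>finite K\<close> by (metis finite_list)
  define r :: "('j \<Rightarrow> real) \<times> real \<Rightarrow> (nat \<Rightarrow> real) \<times> real" where "r = (\<lambda>(c, d). (c \<circ> h, d))"
  define E :: "'n ext_form" where
    "E = \<lparr>ef_dim = card J, ef_ineqs = map r Ll, ef_eqs = map r Kl, ef_map = (\<lambda>i. M i \<circ> h)\<rparr>"
  have sum_h: "(\<Sum>j<card J. f (h j)) = (\<Sum>j\<in>J. f j)" for f :: "'j \<Rightarrow> real"
    using sum.reindex_bij_betw[OF h] .
  have hJ: "h j \<in> J" if "j < card J" for j using h that by (auto simp: bij_betw_def)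
  define S where "S = {y. (\<forall>(c, d)\<in>L. (\<Sum>j\<in>J. c j * y j) \<le> d) \<and> (\<forall>(c, d)\<in>K. (\<Sum>j\<in>J. c j * y j) = d)}"
  \<comment> \<open>Members of \<open>ef_polyhedron\<close> are extensional, hence the
    restriction.\<close>
  have poly: "restrict (y \<circ> h) {..<card J} \<in> ef_polyhedron E \<longleftrightarrow> y \<in> S" for y
  proof -
    have "(\<Sum>j<card J. (c \<circ> h) j * restrict (y \<circ> h) {..<card J} j) = (\<Sum>j\<in>J. c j * y j)" for c
      using sum_h[of "\<lambda>j. c j * y j"] by simp
    then have r_sum: "(\<Sum>j<card J. fst (r p) j * restrict (y \<circ> h) {..<card J} j) = (\<Sum>j\<in>J. fst p j * y j)"
      and "snd (r p) = snd p" for p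
      by (simp_all only: r_def split_beta fst_conv snd_conv)
    moreover have "restrict (y \<circ> h) {..<card J} \<in> ef_polyhedron E \<longleftrightarrow>
      (\<forall>p\<in>L. (\<Sum>j<card J. fst (r p) j * restrict (y \<circ> h) {..<card J} j) \<le> snd (r p)) \<and>
      (\<forall>p\<in>K. (\<Sum>j<card J. fst (r p) j * restrict (y \<circ> h) {..<card J} j) = snd (r p))"
      by (simp add: ef_polyhedron_def E_def Ll Kl split_beta del: restrict_apply)
    ultimately have "restrict (y \<circ> h) {..<card J} \<in> ef_polyhedron E \<longleftrightarrow>
      (\<forall>p\<in>L. (\<Sum>j\<in>J. fst p j * y j) \<le> snd p) \<and> (\<forall>p\<in>K. (\<Sum>j\<in>J. fst p j * y j) = snd p)"
      by (simp only:)
    then show ?thesis by (simp add: S_def split_beta)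
  qed
  have proj: "ef_proj E (restrict (y \<circ> h) {..<card J}) = (\<chi> i. \<Sum>j\<in>J. M i j * y j)" for y
    using sum_h[of "\<lambda>j. M _ j * y j"] by (simp add: ef_proj_def E_def)
  \<comment> \<open>Composition with the inverse of \<open>h\<close> undoes the renumbering; without
    it only one inclusion between the two images would follow.\<close>
  have surj: "\<exists>y. z = restrict (y \<circ> h) {..<card J}" if "z \<in> ef_polyhedron E" for z
  proof
    have "z \<in> {..<card J} \<rightarrow>\<^sub>E UNIV" using that by (simp add: ef_polyhedron_def E_def)
    then show "z = restrict ((z \<circ> inv_into {..<card J} h) \<circ> h) {..<card J}"
      using h by (auto simp: fun_eq_iff bij_betw_def inv_into_f_f PiE_def extensional_def)
  qed
  have "ef_proj E ` ef_polyhedron E = (\<lambda>y. \<chi> i. \<Sum>j\<in>J. M i j * y j) ` S"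
  proof (intro equalityI subsetI)
    fix x assume "x \<in> ef_proj E ` ef_polyhedron E"
    then obtain z where "z \<in> ef_polyhedron E" "x = ef_proj E z" by blast
    with surj[of z] poly proj show "x \<in> (\<lambda>y. \<chi> i. \<Sum>j\<in>J. M i j * y j) ` S" by auto
  next
    fix x assume "x \<in> (\<lambda>y. \<chi> i. \<Sum>j\<in>J. M i j * y j) ` S"
    then obtain y where "y \<in> S" "x = ef_proj E (restrict (y \<circ> h) {..<card J})" using proj by auto
    with poly show "x \<in> ef_proj E ` ef_polyhedron E" by blast
  qed
  moreover have "rational_ext_form E"
    using rat ratM hJ unfolding rational_ext_form_def E_def r_def
    by (fastforce simp: Ll Kl)
  ultimately show ?thesis
    unfolding ext_formulation_of_def S_def[symmetric]
    by (intro exI[of _ E]) (simp add: E_def Ll)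
qed

section \<open>Polyhedra given by inequalities and equations\<close>

text \<open>Inequalities \<open>L\<close> and equations \<open>K\<close> are kept apart because only
  the former are counted by \<open>xc\<close>; passing to a face moves pairs from \<open>L\<close>
  to \<open>K\<close>.\<close>

definition constr_set :: "('a::real_inner \<times> real) set \<Rightarrow> ('a \<times> real) set \<Rightarrow> 'a set" where
  "constr_set L K = {x. (\<forall>(c, d)\<in>L. c \<bullet> x \<le> d) \<and> (\<forall>(c, d)\<in>K. c \<bullet> x = d)}"

lemma constr_set_eq_INT:
  "constr_set L K = (\<Inter>(c, d)\<in>L. {x. c \<bullet> x \<le> d}) \<inter> (\<Inter>(c, d)\<in>K. {x. c \<bullet> x = d})"
  by (auto simp: constr_set_def)

lemma constr_set_convex: "convex (constr_set L K)"
  unfolding constr_set_eq_INT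
  by (auto intro!: convex_Int convex_INT simp: convex_halfspace_le convex_hyperplane)

lemma constr_set_closed: "closed (constr_set L K)"
  unfolding constr_set_eq_INT
  by (auto intro!: closed_Int closed_INT simp: closed_halfspace_le closed_hyperplane)

text \<open>A nonzero solution \<open>x\<close> of the homogeneous system is a recession direction,
  and the ray from any point of the set along \<open>x\<close> would contradict boundedness. This is
  what handles zero multipliers in the disjunctive formulation.\<close>

lemma bounded_constr_set_recession:
  assumes bdd: "bounded (constr_set L K)" and ne: "constr_set L K \<noteq> {}"
    and L: "\<And>c d. (c, d) \<in> L \<Longrightarrow> c \<bullet> x \<le> 0" and K: "\<And>c d. (c, d) \<in> K \<Longrightarrow> c \<bullet> x = 0"
  shows "x = 0"
proof (rule ccontr)
  assume "x \<noteq> 0"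
  obtain z where z: "z \<in> constr_set L K" using ne by blast
  obtain B where B: "\<And>y. y \<in> constr_set L K \<Longrightarrow> norm y \<le> B" using bdd by (auto simp: bounded_iff)
  have ray: "z + t *\<^sub>R x \<in> constr_set L K" if "t \<ge> 0" for t
  proof -
    have "c \<bullet> (z + t *\<^sub>R x) \<le> d" if "(c, d) \<in> L" for c d
      using z that L[OF that] mult_nonneg_nonpos[OF \<open>t \<ge> 0\<close> L[OF that]]
      by (fastforce simp: constr_set_def inner_add_right)
    moreover have "c \<bullet> (z + t *\<^sub>R x) = d" if "(c, d) \<in> K" for c d
      using z that K[OF that] by (auto simp: constr_set_def inner_add_right)
    ultimately show ?thesis by (auto simp: constr_set_def)
  qed
  have "0 \<le> B" using B[OF z] norm_ge_zero[of z] by linarith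
  \<comment> \<open>This makes \<open>t *\<^sub>R x\<close> have norm \<open>2 * B + 1\<close>,
    while two points of norm at most \<open>B\<close> are at most \<open>2 * B\<close>
    apart.\<close>
  define t where "t = (2 * B + 1) / norm x"
  have "t \<ge> 0" using \<open>0 \<le> B\<close> by (simp add: t_def)
  have "2 * B + 1 = norm (t *\<^sub>R x)" using \<open>0 \<le> B\<close> \<open>x \<noteq> 0\<close> by (simp add: t_def)
  also have "\<dots> \<le> norm (z + t *\<^sub>R x) + norm z" by (metis add_diff_cancel_left' norm_triangle_ineq4)
  also have "\<dots> \<le> B + B" using B[OF ray[OF \<open>t \<ge> 0\<close>]] B[OF z] by simp
  finally show False by simp
qed

definition rational_constr :: "((real ^ 'n) \<times> real) set \<Rightarrow> bool" where
  "rational_constr L \<longleftrightarrow> (\<forall>(c, d)\<in>L. d \<in> \<rat> \<and> (\<forall>i. c $ i \<in> \<rat>))"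

text \<open>The identity matrix serves as the linear map. The case of empty \<open>X\<close> relies
  on this, since there the multiplier of a disjunctive formulation would cost one inequality too
  many.\<close>

lemma constr_set_ext_form:
  fixes L K :: "((real ^ 'n) \<times> real) set"
  assumes "finite L" "finite K" "rational_constr L" "rational_constr K"
  shows "\<exists>E :: 'n ext_form. ext_formulation_of E (constr_set L K) \<and> rational_ext_form E \<and>
    length (ef_ineqs E) \<le> card L"
proof -
  let ?r = "\<lambda>(c, d). (\<lambda>i. c $ i, d) :: ('n \<Rightarrow> real) \<times> real"
  let ?M = "\<lambda>i j. if i = j then 1 else 0 :: real"
  obtain E :: "'n ext_form" where E: "ext_formulation_of E ((\<lambda>y. \<chi> i. \<Sum>j\<in>UNIV. ?M i j * y j) `
      {y. (\<forall>(c, d)\<in>?r ` L. (\<Sum>j\<in>UNIV. c j * y j) \<le> d) \<and> (\<forall>(c, d)\<in>?r ` K. (\<Sum>j\<in>UNIV. c j * y j) = d)})"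
    "rational_ext_form E" "length (ef_ineqs E) = card (?r ` L)"
    using finite_index_ext_form[of UNIV "?r ` L" "?r ` K" ?M] assms
    by (fastforce simp: rational_constr_def)
  have M: "(\<chi> i. \<Sum>j\<in>UNIV. ?M i j * y j) = vec_lambda y" for y :: "'n \<Rightarrow> real"
    by (simp add: if_distrib[of "\<lambda>u. u * _"] cong: if_cong)
  have "(\<lambda>y. \<chi> i. \<Sum>j\<in>UNIV. ?M i j * y j) `
      {y. (\<forall>(c, d)\<in>?r ` L. (\<Sum>j\<in>UNIV. c j * y j) \<le> d) \<and> (\<forall>(c, d)\<in>?r ` K. (\<Sum>j\<in>UNIV. c j * y j) = d)}
    = constr_set L K" (is "?f ` ?S = _")
  proof (intro equalityI subsetI)
    fix x assume "x \<in> ?f ` ?S"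
    then obtain y where "y \<in> ?S" "x = vec_lambda y" unfolding M by blast
    then show "x \<in> constr_set L K" by (fastforce simp: constr_set_def inner_vec_def)
  next
    fix x assume "x \<in> constr_set L K"
    then have "(\<lambda>i. x $ i) \<in> ?S" by (fastforce simp: constr_set_def inner_vec_def)
    moreover have "x = vec_lambda (\<lambda>i. x $ i)" by simp
    ultimately show "x \<in> ?f ` ?S" unfolding M by blast
  qed
  then show ?thesis using E card_image_le[OF \<open>finite L\<close>] by metis
qed

text \<open>If all inequalities tight at \<open>w\<close> were tight at \<open>v\<close> too, one
  could step from \<open>w\<close> a little further away from \<open>v\<close> without leaving the
  set, and \<open>w\<close> would lie inside a segment of it.\<close>

lemma extreme_point_tight_constr:
  assumes "finite L" and w: "w extreme_point_of constr_set L K"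
    and v: "v \<in> constr_set L K" "v \<noteq> w"
  shows "\<exists>(c, d)\<in>L. c \<bullet> w = d \<and> c \<bullet> v < d"
proof (rule ccontr)
  assume "\<not> ?thesis"
  with v have tight: "c \<bullet> v = d" if "(c, d) \<in> L" "c \<bullet> w = d" for c d
    using that by (fastforce simp: constr_set_def)
  have w': "w \<in> constr_set L K" using w by (simp add: extreme_point_of_def)
  \<comment> \<open>A tight inequality stays tight along the whole line through \<open>v\<close> and
    \<open>w\<close>; a slack one survives small steps by continuity. Finiteness of \<open>L\<close>
    then yields one step length for all of them.\<close>
  have "\<forall>\<^sub>F e in at_right 0. fst p \<bullet> (w + e *\<^sub>R (w - v)) \<le> snd p" if p: "p \<in> L" for p
  proof (cases "fst p \<bullet> w = snd p")
    case True
    then show ?thesis using tight[of "fst p" "snd p"] p by (simp add: inner_add_right inner_diff_right)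
  next
    case False
    with w' p have "fst p \<bullet> (w + 0 *\<^sub>R (w - v)) < snd p" by (fastforce simp: constr_set_def)
    moreover have "((\<lambda>e. fst p \<bullet> (w + e *\<^sub>R (w - v))) \<longlongrightarrow> fst p \<bullet> (w + 0 *\<^sub>R (w - v))) (at_right 0)"
      by (intro tendsto_intros)
    ultimately show ?thesis by (auto dest!: order_tendstoD(2) elim: eventually_mono)
  qed
  then have "\<forall>\<^sub>F e in at_right (0::real). \<forall>p\<in>L. fst p \<bullet> (w + e *\<^sub>R (w - v)) \<le> snd p"
    using \<open>finite L\<close> by (simp add: eventually_ball_finite)
  then have "\<forall>\<^sub>F e in at_right (0::real). 0 < e \<and> (\<forall>p\<in>L. fst p \<bullet> (w + e *\<^sub>R (w - v)) \<le> snd p)"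
    by (intro eventually_conj eventually_at_right_less)
  then obtain e :: real where e: "0 < e" "\<forall>p\<in>L. fst p \<bullet> (w + e *\<^sub>R (w - v)) \<le> snd p"
    by (auto dest: eventually_happens)
  \<comment> \<open>Seen from \<open>v\<close>, this point lies beyond \<open>w\<close>; the weight
    of \<open>u\<close> that recovers \<open>w\<close> is \<open>1 / (1 + e)\<close>.\<close>
  define u where "u = w + e *\<^sub>R (w - v)"
  have "u \<in> constr_set L K"
    using e v w' by (fastforce simp: u_def constr_set_def inner_add_right inner_diff_right)
  moreover have "w \<in> open_segment v u"
    unfolding in_segment
  proof (intro conjI exI)
    show "v \<noteq> u"
    proof
      assume "v = u"
      then have "(1 + e) *\<^sub>R (w - v) = 0" by (simp add: u_def algebra_simps)
      with e v show False by simp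
    qed
    have "(1 + e) *\<^sub>R w = (1 + e) *\<^sub>R ((1 - 1 / (1 + e)) *\<^sub>R v + (1 / (1 + e)) *\<^sub>R u)"
      using e by (simp add: u_def scaleR_add_right right_diff_distrib) (simp add: algebra_simps)
    then show "w = (1 - 1 / (1 + e)) *\<^sub>R v + (1 / (1 + e)) *\<^sub>R u" using e by simp
  qed (use e in auto)
  ultimately show False using w v by (auto simp: extreme_point_of_def)
qed

section \<open>Irredundant descriptions and facets\<close>

text \<open>In a minimal family of half-spaces that cuts the set out of its affine hull, each
  half-space defines a facet, and distinct ones define distinct facets. Taking \<open>L\<close> and
  \<open>K\<close> from the given rows preserves finiteness and rationality.\<close>

lemma irredundant_constr_set:
  fixes L0 :: "('a::euclidean_space \<times> real) set"
  assumes "finite L0" and ne: "constr_set L0 {} \<noteq> {}"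
  shows "\<exists>L K. L \<subseteq> L0 \<and> K \<subseteq> L0 \<and> constr_set L0 {} = constr_set L K \<and> card L \<le> num_facets (constr_set L0 {})"
proof -
  define P where "P = constr_set L0 {}"
  \<comment> \<open>The implicit equations, which will turn out to describe the affine hull of
    \<open>P\<close>.\<close>
  define K where "K = {p \<in> L0. \<forall>x\<in>P. fst p \<bullet> x = snd p}"
  define H where "H = constr_set {} K"
  have P_le: "fst p \<bullet> x \<le> snd p" if "p \<in> L0" "x \<in> P" for p x
    using that by (force simp: P_def constr_set_def)
  have "convex P" by (simp add: P_def constr_set_convex)
  then obtain z where z: "z \<in> rel_interior P"
    using ne rel_interior_eq_empty by (force simp: P_def)
  then have "z \<in> P" using rel_interior_subset by blast
  \<comment> \<open>From any \<open>x\<close> in \<open>P\<close> the segment to \<open>z\<close>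
    can be prolonged beyond \<open>z\<close> within \<open>P\<close>. If the inequality were tight
    at \<open>z\<close>, it would thus be tight at every \<open>x\<close>, and \<open>p\<close>
    would belong to \<open>K\<close>.\<close>
  have strict: "fst p \<bullet> z < snd p" if p: "p \<in> L0 - K" for p
  proof (rule ccontr)
    assume "\<not> fst p \<bullet> z < snd p"
    with P_le p \<open>z \<in> P\<close> have eq: "fst p \<bullet> z = snd p" by (meson DiffD1 antisym_conv1)
    have "fst p \<bullet> x = snd p" if x: "x \<in> P" for x
    proof -
      obtain e where e: "e > 1" "(1 - e) *\<^sub>R x + e *\<^sub>R z \<in> P"
        using convex_rel_interior_iff[OF \<open>convex P\<close>] ne z x P_def by blast
      have "(1 - e) * (fst p \<bullet> x) + e * snd p \<le> snd p"
        using P_le[OF _ e(2), of p] p eq by (simp add: inner_add_right)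
      then have "(e - 1) * (snd p - fst p \<bullet> x) \<le> 0" by (simp add: algebra_simps)
      with e P_le[of p x] p x show ?thesis by (simp add: mult_le_0_iff)
    qed
    with p show False by (auto simp: K_def)
  qed

  have hull: "affine hull P = H"
  proof (rule antisym)
    have H_eq: "H = (\<Inter>p\<in>K. {x. fst p \<bullet> x = snd p})" by (auto simp: H_def constr_set_def split_beta)
    have affH: "affine H" unfolding H_eq by (auto simp: affine_hyperplane)
    have "P \<subseteq> H" by (auto simp: H_eq K_def)
    then show "affine hull P \<subseteq> H" using affH by (simp add: hull_minimal)
    \<comment> \<open>\<open>H \<inter> U\<close> is a relatively open part of \<open>H\<close> that
      lies in \<open>P\<close> and contains \<open>z\<close>, so it already spans
      \<open>H\<close>.\<close>
    define U where "U = (\<Inter>p\<in>L0 - K. {x. fst p \<bullet> x < snd p})"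
    have "open U" unfolding U_def using \<open>finite L0\<close> by (auto simp: open_halfspace_lt)
    then have "affine hull (H \<inter> U) = H" if "H \<inter> U \<noteq> {}"
      using affine_hull_affine_Int_open[OF affH _ that] affH by simp
    moreover have "z \<in> H \<inter> U" using strict \<open>z \<in> P\<close> \<open>P \<subseteq> H\<close> by (auto simp: U_def)
    ultimately have "affine hull (H \<inter> U) = H" by auto
    moreover have "H \<inter> U \<subseteq> P"
      by (force simp: H_eq U_def P_def constr_set_def)
    ultimately show "H \<subseteq> affine hull P" by (metis hull_mono)
  qed

  \<comment> \<open>Only nonzero normals define proper half-spaces. A row outside \<open>K\<close>
    with zero normal holds everywhere, because by \<open>strict\<close> its right-hand side is
    positive.\<close>
  define N where "N = {p \<in> L0 - K. fst p \<noteq> 0}"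
  define hp :: "'a \<times> real \<Rightarrow> 'a set" where "hp p = {x. fst p \<bullet> x \<le> snd p}" for p
  have P_eq: "P = H \<inter> \<Inter>(hp ` N)"
  proof
    show "P \<subseteq> H \<inter> \<Inter>(hp ` N)"
      using hull hull_subset[of P affine] P_le by (auto simp: N_def hp_def)
    show "H \<inter> \<Inter>(hp ` N) \<subseteq> P"
    proof
      fix x assume x: "x \<in> H \<inter> \<Inter>(hp ` N)"
      have "fst p \<bullet> x \<le> snd p" if p: "p \<in> L0" for p
      proof (cases "p \<in> K \<or> p \<in> N")
        case True
        with x show ?thesis by (force simp: H_def constr_set_def hp_def)
      next
        case False
        with p strict[of p] show ?thesis by (auto simp: N_def)
      qed
      then show "x \<in> P" by (force simp: P_def constr_set_def)
    qed
  qed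
  have "finite N" using \<open>finite L0\<close> by (simp add: N_def)
  then have fin: "finite {G \<in> Pow (hp ` N). P = H \<inter> \<Inter>G}" by simp
  have hpN: "hp ` N \<in> {G \<in> Pow (hp ` N). P = H \<inter> \<Inter>G}" using P_eq by simp
  \<comment> \<open>Minimality is taken over sets of half-spaces, not over rows, so rows that are
    positive multiples of one another count once.\<close>
  obtain G where "G \<in> {G \<in> Pow (hp ` N). P = H \<inter> \<Inter>G}"
    and min: "\<forall>G'\<in>{G \<in> Pow (hp ` N). P = H \<inter> \<Inter>G}. G' \<subseteq> G \<longrightarrow> G = G'"
    using finite_has_minimal2[OF fin hpN] by (elim bexE conjE)
  then have G: "G \<subseteq> hp ` N" "P = H \<inter> \<Inter>G" by simp_all
  have G_min: "P \<noteq> H \<inter> \<Inter>G'" if "G' \<subset> G" for G'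
    using min that G(1) by blast
  have "finite G" using G \<open>finite N\<close> finite_surj by blast
  \<comment> \<open>One row is chosen to represent each half-space that was kept.\<close>
  obtain r where r: "\<And>h. h \<in> G \<Longrightarrow> r h \<in> N \<and> h = hp (r h)"
    using G(1) by (metis (no_types, lifting) image_iff subsetD)
  define facet where "facet h = P \<inter> {x. fst (r h) \<bullet> x = snd (r h)}" for h
  have facets: "{F. F facet_of P} = facet ` G"
  proof -
    have 1: "P = affine hull P \<inter> \<Inter>G" using G hull by simp
    have 2: "fst (r h) \<noteq> 0 \<and> h = {x. fst (r h) \<bullet> x \<le> snd (r h)}" if "h \<in> G" for h
      using r[OF that] by (auto simp: N_def hp_def)
    have 3: "P \<subset> affine hull P \<inter> \<Inter>G'" if "G' \<subset> G" for G'
      using G_min[OF that] G(2) that unfolding hull by blast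
    show ?thesis
      using facet_of_polyhedron_explicit[OF \<open>finite G\<close> 1 2 3] by (auto simp: facet_def)
  qed
  \<comment> \<open>By irredundance, some point of the affine hull violates only the constraint h; the segment to it
    from the relative interior point z crosses the facet of h in the relative interior of that facet.\<close>
  have "inj_on facet G"
  proof (rule inj_onI, rule ccontr)
    fix h h' assume h: "h \<in> G" "h' \<in> G" "facet h = facet h'" "h \<noteq> h'"
    have "P \<subset> H \<inter> \<Inter>(G - {h})" using G_min[of "G - {h}"] G(2) h by blast
    then obtain y where y: "y \<in> H" "y \<in> \<Inter>(G - {h})" "y \<notin> h" using G(2) by blast
    define c d where "c = fst (r h)" and "d = snd (r h)"
    have "c \<bullet> z < d" using r[OF h(1)] strict by (auto simp: c_def d_def N_def)
    have "d < c \<bullet> y" using y(3) r[OF h(1)] by (simp add: c_def d_def hp_def set_eq_iff) 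
    define t where "t = (d - c \<bullet> z) / (c \<bullet> y - c \<bullet> z)"
    have t: "0 < t" "t < 1" using \<open>c \<bullet> z < d\<close> \<open>d < c \<bullet> y\<close> by (auto simp: t_def)
    define x where "x = (1 - t) *\<^sub>R z + t *\<^sub>R y"
    have cx: "c \<bullet> x = d"
    proof -
      have "c \<bullet> x = c \<bullet> z + t * (c \<bullet> y - c \<bullet> z)" by (simp add: x_def inner_add_right algebra_simps)
      also have "\<dots> = d" using \<open>c \<bullet> z < d\<close> \<open>d < c \<bullet> y\<close> by (simp add: t_def)
      finally show ?thesis .
    qed
    have x_strict: "fst (r k) \<bullet> x < snd (r k)" if k: "k \<in> G" "k \<noteq> h" for k
    proof -
      have "fst (r k) \<bullet> y \<le> snd (r k)" using y(2) k r[OF k(1)] by (auto simp: hp_def)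
      moreover have "fst (r k) \<bullet> z < snd (r k)" using r[OF k(1)] strict by (auto simp: N_def)
      ultimately have "(1 - t) * (fst (r k) \<bullet> z) + t * (fst (r k) \<bullet> y) < (1 - t) * snd (r k) + t * snd (r k)"
        using t by (intro add_less_le_mono mult_strict_left_mono mult_left_mono) auto
      then show ?thesis by (simp add: x_def inner_add_right algebra_simps)
    qed
    have "x \<in> H"
      using y(1) hull_inc[OF \<open>z \<in> P\<close>, of affine] t affine_affine_hull[of P]
      unfolding hull x_def by (simp add: mem_affine)
    moreover have "x \<in> k" if "k \<in> G" for k
    proof -
      have "fst (r k) \<bullet> x \<le> snd (r k)"
        using x_strict[OF that] cx by (cases "k = h") (auto simp: c_def d_def)
      then show ?thesis using r[OF that] by (auto simp: hp_def)
    qed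
    ultimately have "x \<in> facet h" using G(2) cx by (auto simp: facet_def c_def d_def)
    moreover have "x \<notin> facet h'" using x_strict[of h'] h by (auto simp: facet_def)
    ultimately show False using h by simp
  qed
  then have "card (r ` G) \<le> num_facets P"
    unfolding num_facets_def facets using card_image_le[OF \<open>finite G\<close>] by (simp add: card_image)
  moreover have "r ` G \<subseteq> L0" "K \<subseteq> L0" using r by (auto simp: N_def K_def)
  moreover have "P = constr_set (r ` G) K"
  proof -
    have "\<Inter>G = {x. \<forall>(c, d)\<in>r ` G. c \<bullet> x \<le> d}"
      using r by (force simp: hp_def)
    then show ?thesis using G(2) by (auto simp: H_def constr_set_def)
  qed
  ultimately show ?thesis unfolding P_def by blast
qed

section \<open>Balas' formulation for the convex hull of a union\<close>

text \<open>A convex combination of points of the pieces is encoded by a multiplier and a scaled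
  point for each piece, which makes all constraints linear. The summand 1 per piece is the
  nonnegativity of its multiplier.\<close>

lemma convex_hull_UN_ext_form:
  fixes L K :: "'i \<Rightarrow> ((real ^ 'n) \<times> real) set"
  assumes fin: "finite I" "\<And>i. i \<in> I \<Longrightarrow> finite (L i)" "\<And>i. i \<in> I \<Longrightarrow> finite (K i)"
    and rat: "\<And>i. i \<in> I \<Longrightarrow> rational_constr (L i)" "\<And>i. i \<in> I \<Longrightarrow> rational_constr (K i)"
    and bdd: "\<And>i. i \<in> I \<Longrightarrow> bounded (constr_set (L i) (K i))"
    and ne: "\<And>i. i \<in> I \<Longrightarrow> constr_set (L i) (K i) \<noteq> {}"
  shows "\<exists>E :: 'n ext_form.
    ext_formulation_of E (convex hull (\<Union>i\<in>I. constr_set (L i) (K i))) \<and> rational_ext_form E \<and>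
    length (ef_ineqs E) \<le> (\<Sum>i\<in>I. card (L i) + 1)"
proof -
  \<comment> \<open>The index \<open>(i, None)\<close> carries the multiplier of piece
    \<open>i\<close>, and \<open>(i, Some k)\<close> coordinate \<open>k\<close> of its scaled
    point.\<close>
  define J :: "('i \<times> 'n option) set" where "J = I \<times> UNIV"
  define hom :: "'i \<Rightarrow> (real ^ 'n) \<times> real \<Rightarrow> ('i \<times> 'n option \<Rightarrow> real) \<times> real" where
    "hom i = (\<lambda>(c, d). (\<lambda>(i', k). if i' = i then (case k of None \<Rightarrow> - d | Some k \<Rightarrow> c $ k) else 0, 0))" for i
  \<comment> \<open>The pair \<open>(0, 1)\<close> homogenises to the nonnegativity of the
    multiplier.\<close>
  define L' where "L' = (\<Union>i\<in>I. hom i ` insert (0, 1) (L i))"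
  \<comment> \<open>The inserted equation makes the multipliers sum to 1.\<close>
  define K' where "K' = insert (\<lambda>(i, k). if k = None then 1 else 0, 1) (\<Union>i\<in>I. hom i ` K i)"
  define M :: "'n \<Rightarrow> 'i \<times> 'n option \<Rightarrow> real" where "M k = (\<lambda>(i, k'). if k' = Some k then 1 else 0)" for k
  define T where "T = {y. (\<forall>(c, d)\<in>L'. (\<Sum>j\<in>J. c j * y j) \<le> d) \<and> (\<forall>(c, d)\<in>K'. (\<Sum>j\<in>J. c j * y j) = d)}"
  define part :: "('i \<times> 'n option \<Rightarrow> real) \<Rightarrow> 'i \<Rightarrow> real ^ 'n" where "part y i = (\<chi> k. y (i, Some k))" for y i

  have sum_J: "(\<Sum>j\<in>J. f j) = (\<Sum>i\<in>I. f (i, None) + (\<Sum>k\<in>UNIV. f (i, Some k)))"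
    for f :: "'i \<times> 'n option \<Rightarrow> real"
  proof -
    have "(\<Sum>j\<in>J. f j) = (\<Sum>i\<in>I. \<Sum>k\<in>UNIV. f (i, k))"
      by (simp add: J_def sum.cartesian_product split_beta)
    then show ?thesis by (simp add: UNIV_option_conv sum.reindex)
  qed
  have sum_hom: "(\<Sum>j\<in>J. fst (hom i p) j * y j) = fst p \<bullet> part y i - snd p * y (i, None)" if "i \<in> I" for i p y
  proof -
    have "(\<Sum>j\<in>J. fst (hom i p) j * y j) =
      (\<Sum>i'\<in>I. if i' = i then fst p \<bullet> part y i - snd p * y (i, None) else 0)"
      unfolding sum_J by (intro sum.cong) (auto simp: hom_def inner_vec_def part_def split_beta)
    then show ?thesis using that fin by simp
  qed
  have snd_hom: "snd (hom i p) = 0" for i p by (simp add: hom_def split_beta)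
  have M: "(\<chi> k. \<Sum>j\<in>J. M k j * y j) = (\<Sum>i\<in>I. part y i)" for y
    unfolding sum_J by (simp add: vec_eq_iff M_def part_def if_distrib[of "\<lambda>u. u * _"] cong: if_cong)
  have T_iff: "y \<in> T \<longleftrightarrow> (\<forall>i\<in>I. 0 \<le> y (i, None) \<and>
      (\<forall>(c, d)\<in>L i. c \<bullet> part y i \<le> d * y (i, None)) \<and> (\<forall>(c, d)\<in>K i. c \<bullet> part y i = d * y (i, None))) \<and>
      (\<Sum>i\<in>I. y (i, None)) = 1" for y
  proof -
    have lam: "(\<Sum>j\<in>J. (if snd j = None then 1 else 0) * y j) = (\<Sum>i\<in>I. y (i, None))"
      by (simp add: sum_J)
    have "y \<in> T \<longleftrightarrow> (\<forall>i\<in>I. \<forall>p\<in>insert (0, 1) (L i). (\<Sum>j\<in>J. fst (hom i p) j * y j) \<le> 0) \<and>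
      (\<forall>i\<in>I. \<forall>p\<in>K i. (\<Sum>j\<in>J. fst (hom i p) j * y j) = 0) \<and> (\<Sum>i\<in>I. y (i, None)) = 1"
      by (simp add: T_def L'_def K'_def split_beta snd_hom lam) blast
    then show ?thesis by (simp add: sum_hom split_beta ball_conj_distrib cong: ball_cong)
  qed
  have img: "(\<lambda>y. \<Sum>i\<in>I. part y i) ` T = convex hull (\<Union>i\<in>I. constr_set (L i) (K i))"
  proof (intro equalityI subsetI)
    fix x assume "x \<in> (\<lambda>y. \<Sum>i\<in>I. part y i) ` T"
    then obtain y where y: "y \<in> T" and x: "x = (\<Sum>i\<in>I. part y i)" by blast
    have y_nonneg: "0 \<le> y (i, None)" if "i \<in> I" for i using y that by (simp add: T_iff)
    have y_sum: "(\<Sum>i\<in>I. y (i, None)) = 1" using y by (simp add: T_iff)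
    have y_L: "c \<bullet> part y i \<le> d * y (i, None)" if "i \<in> I" "(c, d) \<in> L i" for i c d
      using y that unfolding T_iff by blast
    have y_K: "c \<bullet> part y i = d * y (i, None)" if "i \<in> I" "(c, d) \<in> K i" for i c d
      using y that unfolding T_iff by blast
    have "\<exists>s. s \<in> constr_set (L i) (K i) \<and> part y i = y (i, None) *\<^sub>R s" if i: "i \<in> I" for i
    \<comment> \<open>With multiplier zero the scaled point vanishes, so any point of the nonempty
      piece will do for \<open>s\<close>; otherwise the scaled point is divided by its
      multiplier.\<close>
    proof (cases "y (i, None) = 0")
      case True
      have "part y i = 0"
        by (rule bounded_constr_set_recession[OF bdd[OF i] ne[OF i]]) (use y_L[OF i] y_K[OF i] True in auto)
      then show ?thesis using True ne[OF i] by auto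
    next
      case False
      with y_nonneg[OF i] have pos: "0 < y (i, None)" by simp
      have "part y i /\<^sub>R y (i, None) \<in> constr_set (L i) (K i)"
        using y_L[OF i] y_K[OF i] pos by (auto simp: constr_set_def field_simps)
      moreover have "part y i = y (i, None) *\<^sub>R (part y i /\<^sub>R y (i, None))" using pos by simp
      ultimately show ?thesis by blast
    qed
    then obtain s where s: "\<And>i. i \<in> I \<Longrightarrow> s i \<in> constr_set (L i) (K i)"
      "\<And>i. i \<in> I \<Longrightarrow> part y i = y (i, None) *\<^sub>R s i" by metis
    have "(\<Sum>i\<in>I. y (i, None) *\<^sub>R s i) \<in> convex hull (\<Union>i\<in>I. constr_set (L i) (K i))"
      using s(1) by (intro convex_sum fin(1) convex_convex_hull y_sum y_nonneg) (auto intro: hull_inc)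
    then show "x \<in> convex hull (\<Union>i\<in>I. constr_set (L i) (K i))" using s(2) x by simp
  next
    fix x assume "x \<in> convex hull (\<Union>i\<in>I. constr_set (L i) (K i))"
    then obtain u s where us: "\<forall>i\<in>I. 0 \<le> u i" "sum u I = 1"
      "\<forall>i\<in>I. s i \<in> constr_set (L i) (K i)" "x = (\<Sum>i\<in>I. u i *\<^sub>R s i)"
      using convex_hull_finite_union[of I "\<lambda>i. constr_set (L i) (K i)"] fin(1) ne
      by (auto simp: constr_set_convex)
    define y where "y = (\<lambda>(i, k). case k of None \<Rightarrow> u i | Some k \<Rightarrow> u i * s i $ k)"
    have part: "part y i = u i *\<^sub>R s i" for i by (simp add: part_def y_def vec_eq_iff)
    have None: "y (i, None) = u i" for i by (simp add: y_def)
    have "y \<in> T"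
      unfolding T_iff part None
    proof (intro conjI ballI)
      fix i assume i: "i \<in> I"
      show "0 \<le> u i" using us i by blast
      have si: "s i \<in> constr_set (L i) (K i)" using us i by blast
      show "case p of (c, d) \<Rightarrow> c \<bullet> (u i *\<^sub>R s i) \<le> d * u i" if "p \<in> L i" for p
        using si that \<open>0 \<le> u i\<close> by (auto simp: constr_set_def mult.commute[of _ "u i"] intro!: mult_left_mono)
      show "case p of (c, d) \<Rightarrow> c \<bullet> (u i *\<^sub>R s i) = d * u i" if "p \<in> K i" for p
        using si that by (auto simp: constr_set_def)
    qed (rule us(2))
    then show "x \<in> (\<lambda>y. \<Sum>i\<in>I. part y i) ` T" by (intro image_eqI[of _ _ y]) (simp_all add: us(4) part)
  qed
  have ratJ: "d \<in> \<rat> \<and> (\<forall>j\<in>J. c j \<in> \<rat>)" if "(c, d) \<in> L' \<union> K'" for c d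
    using that rat unfolding L'_def K'_def hom_def rational_constr_def
    by (fastforce split: option.splits)
  have ratM: "M k j \<in> \<rat>" for k j by (simp add: M_def split_beta)
  have fin': "finite J" "finite L'" "finite K'" using fin by (auto simp: J_def L'_def K'_def)
  have "\<exists>E :: 'n ext_form. ext_formulation_of E ((\<lambda>y. \<chi> k. \<Sum>j\<in>J. M k j * y j) ` T) \<and>
    rational_ext_form E \<and> length (ef_ineqs E) = card L'"
    unfolding T_def by (rule finite_index_ext_form[OF fin']) (erule ratJ, rule ratM)
  then obtain E :: "'n ext_form" where E:
    "ext_formulation_of E ((\<lambda>y. \<chi> k. \<Sum>j\<in>J. M k j * y j) ` T)" "rational_ext_form E"
    "length (ef_ineqs E) = card L'"
    by (elim exE conjE)
  have "card L' \<le> (\<Sum>i\<in>I. card (hom i ` insert (0, 1) (L i)))"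
    unfolding L'_def by (rule card_UN_le[OF fin(1)])
  also have "\<dots> \<le> (\<Sum>i\<in>I. card (L i) + 1)"
  proof (rule sum_mono)
    fix i assume "i \<in> I"
    then have "card (hom i ` insert (0, 1) (L i)) \<le> card (insert (0, 1) (L i))" using fin by (intro card_image_le) auto
    also have "\<dots> \<le> card (L i) + 1" by (simp add: card_insert_if fin \<open>i \<in> I\<close>)
    finally show "card (hom i ` insert (0, 1) (L i)) \<le> card (L i) + 1" .
  qed
  finally show ?thesis using E img unfolding M by auto
qed

section \<open>Faces that avoid the forbidden vertices\<close>

text \<open>An equation implies the inequality it came from, so the pairs of \<open>S\<close> can be
  removed from the inequalities. This removal is what the final count exploits.\<close>

lemma constr_set_tight:
  "constr_set (L - S) (K \<union> S) = constr_set L K \<inter> {x. \<forall>(c, d)\<in>S. c \<bullet> x = d}"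
proof (intro set_eqI iffI)
  fix x assume x: "x \<in> constr_set (L - S) (K \<union> S)"
  then have S: "\<forall>(c, d)\<in>S. c \<bullet> x = d" and K: "\<forall>(c, d)\<in>K. c \<bullet> x = d"
    by (simp_all add: constr_set_def ball_Un)
  have "c \<bullet> x \<le> d" if "(c, d) \<in> L" for c d
    using that x bspec[OF S, of "(c, d)"] by (cases "(c, d) \<in> S") (auto simp: constr_set_def)
  with S K show "x \<in> constr_set L K \<inter> {x. \<forall>(c, d)\<in>S. c \<bullet> x = d}" by (auto simp: constr_set_def)
next
  fix x assume "x \<in> constr_set L K \<inter> {x. \<forall>(c, d)\<in>S. c \<bullet> x = d}"
  then show "x \<in> constr_set (L - S) (K \<union> S)" by (auto simp: constr_set_def)
qed

text \<open>Each inequality of \<open>S\<close> defines a supporting hyperplane, and an intersection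
  of faces is a face.\<close>

lemma constr_set_tight_face:
  assumes "S \<subseteq> L"
  shows "constr_set (L - S) (K \<union> S) face_of constr_set L K"
proof (cases "S = {}")
  case True
  then show ?thesis by (simp add: constr_set_convex face_of_refl)
next
  case False
  have "constr_set (L - S) (K \<union> S) = (\<Inter>p\<in>S. constr_set L K \<inter> {x. fst p \<bullet> x = snd p})"
    using False by (auto simp: constr_set_tight split_beta)
  also have "\<dots> face_of constr_set L K"
  proof (rule face_of_Inter)
    fix F assume "F \<in> (\<lambda>p. constr_set L K \<inter> {x. fst p \<bullet> x = snd p}) ` S"
    then obtain p where p: "p \<in> L" "F = constr_set L K \<inter> {x. fst p \<bullet> x = snd p}" using assms by blast
    have "fst p \<bullet> x \<le> snd p" if "x \<in> constr_set L K" for x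
      using that p(1) by (auto simp: constr_set_def split_beta)
    then show "F face_of constr_set L K"
      unfolding p(2) by (intro face_of_Int_supporting_hyperplane_le constr_set_convex)
  qed (use False in simp)
  finally show ?thesis .
qed

text \<open>A function \<open>g\<close> picks for each forbidden vertex \<open>v\<close> an
  inequality that is slack at \<open>v\<close>; making all picks tight yields a face without
  forbidden vertices. Empty faces are discarded because the disjunctive formulation asks for
  nonempty pieces.\<close>

lemma forb_constr_set:
  fixes L K :: "('a::euclidean_space \<times> real) set"
  assumes "finite L" "bounded (constr_set L K)" and X: "X \<subseteq> vert (constr_set L K)"
  shows "forb (constr_set L K) X = convex hull
    (\<Union>g\<in>{g \<in> X \<rightarrow>\<^sub>E L. (\<forall>v\<in>X. fst (g v) \<bullet> v \<noteq> snd (g v)) \<and> constr_set (L - g ` X) (K \<union> g ` X) \<noteq> {}}.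
      constr_set (L - g ` X) (K \<union> g ` X))"
    (is "_ = convex hull (\<Union>g\<in>?I. ?Q g)")
proof (rule antisym)
  let ?P = "constr_set L K"
  \<comment> \<open>For each \<open>v\<close> in \<open>X\<close>, an inequality tight at
    \<open>w\<close> but not at \<open>v\<close> is picked; \<open>w\<close> itself then shows that
    the face is nonempty.\<close>
  have "w \<in> (\<Union>g\<in>?I. ?Q g)" if w: "w \<in> vert ?P - X" for w
  proof -
    have w': "w extreme_point_of ?P" using w by (simp add: vert_def)
    have "\<exists>p. p \<in> L \<and> fst p \<bullet> w = snd p \<and> fst p \<bullet> v < snd p" if v: "v \<in> X" for v
    proof -
      have "v \<in> ?P" "v \<noteq> w" using v X w by (auto simp: vert_def extreme_point_of_def)
      from extreme_point_tight_constr[OF \<open>finite L\<close> w' this] show ?thesis by force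
    qed
    then obtain g where g: "\<And>v. v \<in> X \<Longrightarrow> g v \<in> L \<and> fst (g v) \<bullet> w = snd (g v) \<and> fst (g v) \<bullet> v < snd (g v)"
      by metis
    let ?g = "restrict g X"
    have sub: "?g ` X \<subseteq> L" using g by auto
    have "w \<in> ?Q ?g"
      unfolding constr_set_tight using w' g by (auto simp: extreme_point_of_def split_beta)
    moreover from this have "?g \<in> ?I" using g by fastforce
    ultimately show ?thesis by blast
  qed
  then show "forb ?P X \<subseteq> convex hull (\<Union>g\<in>?I. ?Q g)"
    unfolding forb_def by (intro hull_mono) blast
next
  let ?P = "constr_set L K"
  \<comment> \<open>The face is compact, hence the convex hull of its extreme points. These are
    vertices of the whole polytope, and a point \<open>x\<close> of \<open>X\<close> among them
    would violate the equation \<open>g x\<close>.\<close>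
  have "?Q g \<subseteq> forb ?P X" if g: "g \<in> ?I" for g
  proof -
    have sub: "g ` X \<subseteq> L" using g by auto
    have face: "?Q g face_of ?P" by (rule constr_set_tight_face[OF sub])
    have "compact ?P" using assms(2) constr_set_closed compact_eq_bounded_closed by blast
    then have "compact (?Q g)" using face face_of_imp_compact constr_set_convex by blast
    then have "?Q g = convex hull {x. x extreme_point_of ?Q g}"
      by (intro Krein_Milman_Minkowski constr_set_convex)
    also have "\<dots> \<subseteq> forb ?P X"
      unfolding forb_def
    proof (intro hull_mono subsetI)
      fix x assume "x \<in> {x. x extreme_point_of ?Q g}"
      then have x: "x extreme_point_of ?P" "x \<in> ?Q g"
        using extreme_point_of_face[OF face] by auto
      have "x \<notin> X"
      proof
        assume "x \<in> X"
        with x(2) have "fst (g x) \<bullet> x = snd (g x)"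
          unfolding constr_set_tight by (auto simp: split_beta)
        with g \<open>x \<in> X\<close> show False by simp
      qed
      with x show "x \<in> vert ?P - X" by (simp add: vert_def)
    qed
    finally show ?thesis .
  qed
  then show "convex hull (\<Union>g\<in>?I. ?Q g) \<subseteq> forb ?P X"
    by (intro hull_minimal UN_least) (auto simp: forb_def)
qed

section \<open>Counting the inequalities\<close>

text \<open>There are at most \<open>card L ^ card X\<close> choice functions, and for nonempty
  \<open>X\<close> each contributes at most \<open>card L\<close> inequalities. For empty
  \<open>X\<close> the set is the polytope itself, and its own description is used.\<close>

lemma forb_ext_form:
  fixes L K :: "((real ^ 'n) \<times> real) set"
  assumes fin: "finite L" "finite K" and rat: "rational_constr L" "rational_constr K"
    and bdd: "bounded (constr_set L K)" and X: "finite X" "X \<subseteq> vert (constr_set L K)"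
  shows "\<exists>E :: 'n ext_form. ext_formulation_of E (forb (constr_set L K) X) \<and> rational_ext_form E \<and>
    length (ef_ineqs E) \<le> card L ^ (card X + 1)"
proof (cases "X = {}")
  case True
  have "compact (constr_set L K)" using bdd constr_set_closed compact_eq_bounded_closed by blast
  then have "forb (constr_set L K) X = constr_set L K"
    using Krein_Milman_Minkowski[OF _ constr_set_convex, symmetric] True by (simp add: forb_def vert_def)
  then show ?thesis using constr_set_ext_form[OF fin rat] True by simp
next
  case False
  define I where "I = {g \<in> X \<rightarrow>\<^sub>E L. (\<forall>v\<in>X. fst (g v) \<bullet> v \<noteq> snd (g v)) \<and>
    constr_set (L - g ` X) (K \<union> g ` X) \<noteq> {}}"
  have sub: "I \<subseteq> X \<rightarrow>\<^sub>E L" by (auto simp: I_def)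
  have finPi: "finite (X \<rightarrow>\<^sub>E L)" using X fin by (simp add: finite_PiE)
  then have "finite I" using sub finite_subset by blast
  have gX: "g ` X \<subseteq> L" if "g \<in> I" for g using PiE_mem[OF subsetD[OF sub that]] by blast
  have "\<exists>E :: 'n ext_form.
    ext_formulation_of E (convex hull (\<Union>g\<in>I. constr_set (L - g ` X) (K \<union> g ` X))) \<and> rational_ext_form E \<and>
    length (ef_ineqs E) \<le> (\<Sum>g\<in>I. card (L - g ` X) + 1)"
  proof (rule convex_hull_UN_ext_form)
    fix g assume g: "g \<in> I"
    show "rational_constr (L - g ` X)" using rat(1) by (auto simp: rational_constr_def)
    show "rational_constr (K \<union> g ` X)" using rat gX[OF g] unfolding rational_constr_def by blast
    show "bounded (constr_set (L - g ` X) (K \<union> g ` X))"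
      using bdd unfolding constr_set_tight by (simp add: bounded_Int)
    show "constr_set (L - g ` X) (K \<union> g ` X) \<noteq> {}" using g by (simp add: I_def)
  qed (use fin X \<open>finite I\<close> in auto)
  then obtain E :: "'n ext_form" where E: "ext_formulation_of E (forb (constr_set L K) X)"
    "rational_ext_form E" "length (ef_ineqs E) \<le> (\<Sum>g\<in>I. card (L - g ` X) + 1)"
    unfolding I_def forb_constr_set[OF fin(1) bdd X(2), symmetric] by blast
  note E(3)
  \<comment> \<open>For nonempty X at least one inequality turns into an equation, which pays for the
    nonnegativity of the multiplier.\<close>
  also have "(\<Sum>g\<in>I. card (L - g ` X) + 1) \<le> (\<Sum>g\<in>I. card L)"
  proof (rule sum_mono)
    fix g assume "g \<in> I"
    then have "L - g ` X \<subset> L" using gX[of g] False by blast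
    from psubset_card_mono[OF fin(1) this] show "card (L - g ` X) + 1 \<le> card L" by simp
  qed
  also have "\<dots> \<le> card (X \<rightarrow>\<^sub>E L) * card L" using card_mono[OF finPi sub] by simp
  also have "\<dots> = card L ^ (card X + 1)" using X(1) by (simp add: card_PiE)
  finally show ?thesis using E by blast
qed

theorem proposition6:
  fixes A :: "real ^ 'n ^ 'm" and b :: "real ^ 'm"
    and P X :: "(real ^ 'n) set"
  assumes "\<And>i j. A $ i $ j \<in> \<rat>" and "\<And>i. b $ i \<in> \<rat>"
    and "P = {x. \<forall>i. (A *v x) $ i \<le> b $ i}"
    and "polytope P" and "P \<noteq> {}"
    and "X \<subseteq> vert P"
  shows "(\<exists>E :: 'n ext_form.
            ext_formulation_of E (forb P X) \<and> rational_ext_form E \<and>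
            length (ef_ineqs E) \<le> num_facets P ^ (card X + 1)) \<and>
         xc (forb P X) \<le> enat (num_facets P ^ (card X + 1))"
proof -
  define L0 where "L0 = range (\<lambda>i. (A $ i, b $ i))"
  have P: "P = constr_set L0 {}"
    by (auto simp: assms(3) constr_set_def L0_def matrix_vector_mul_component)
  have "finite L0" by (simp add: L0_def)
  have rat: "rational_constr L0" using assms(1,2) by (auto simp: rational_constr_def L0_def)
  obtain L K where LK: "L \<subseteq> L0" "K \<subseteq> L0" "P = constr_set L K" "card L \<le> num_facets P"
    using irredundant_constr_set[OF \<open>finite L0\<close>] \<open>P \<noteq> {}\<close> unfolding P by blast
  \<comment> \<open>Finiteness makes \<open>card X\<close> the true size of \<open>X\<close>; the
    cardinality of an infinite set would be 0.\<close>
  have "finite X"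
    using finite_polyhedron_extreme_points[OF polytope_imp_polyhedron[OF \<open>polytope P\<close>]] \<open>X \<subseteq> vert P\<close>
    by (auto simp: vert_def intro: finite_subset)
  have "rational_constr L" "rational_constr K"
    using rat LK by (auto simp: rational_constr_def)
  moreover have "finite L" "finite K" using LK \<open>finite L0\<close> finite_subset by auto
  ultimately obtain E :: "'n ext_form" where E: "ext_formulation_of E (forb P X)" "rational_ext_form E"
    "length (ef_ineqs E) \<le> card L ^ (card X + 1)"
    using forb_ext_form[of L K X] \<open>finite X\<close> \<open>X \<subseteq> vert P\<close> polytope_imp_bounded[OF \<open>polytope P\<close>]
    unfolding LK(3) by blast
  have "card L ^ (card X + 1) \<le> num_facets P ^ (card X + 1)"
    using LK(4) by (rule power_mono) simp
  with E(3) have len: "length (ef_ineqs E) \<le> num_facets P ^ (card X + 1)" by linarith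
  have "xc (forb P X) \<le> enat (length (ef_ineqs E))"
    unfolding xc_def by (rule INF_lower) (simp add: E(1))
  also have "\<dots> \<le> enat (num_facets P ^ (card X + 1))" using len by simp
  finally show ?thesis using E len by blast
qed

end
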